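(* Let $(X,\mathcal A,\mu)$ be a $\sigma$-finite complete measure space, $T:X\to X$ a non-singular measurable transformation with $\mu(T(A))\le\mu(A)$ for each $A\in\mathcal A$, and $u:X\to\mathbb C$ a measurable function, not a.e. zero, such that $W_{u,T}$ is a bounded operator on $L(p,q)$. Assume that for each $k\in\mathbb N\cup\{0\}$ there are measurable sets $A_1^k\subseteq\mathcal E_1^k$ and $A_2^k\subseteq\mathcal E_2^k$ with non-zero finite measure satisfying $T_k(A_1^k)=T_k(A_2^k)$, where $T_k:T^k(N_{k+1})\to T^{k+1}(N_{k+1})$ is the restriction of $T$. Then $\beta(W_{u,T})=\infty$.
   Context: For measurable $h:X\to\mathbb C$ put $\mu_h(s)=\mu(\{x\in X:|h(x)|>s\})$ for $s\ge 0$, $h^*(t)=\inf\{s>0:\mu_h(s)\le t\}$ and $h^{**}(t)=\frac1t\int_0^t h^*(s)\,ds$ for $t>0$. The Lorentz space $L(p,q)$ (for $1<p<\infty$, $1\le q<\infty$, or $1<p\le\infty$, $q=\infty$) is the Banach space of (a.e.-equivalence classes of) measurable $h:X\to\mathbb C$ with $\|h\|_{pq}<\infty$, where $\|h\|_{pq}=\left(\frac qp\int_0^\infty (t^{1/p}h^{**}(t))^q\frac{dt}{t}\right)^{1/q}$ if $1<p<\infty$, $1\le q<\infty$, and $\|h\|_{pq}=\sup_{t>0}t^{1/p}h^{**}(t)$ if $1<p\le\infty$, $q=\infty$. A measurable transformation $T:X\to X$ is non-singular if $\mu(A)=0$ implies $\mu(T^{-1}(A))=0$. The hypothesis $\mu(T(A))\le\mu(A)$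 for $A\in\mathcal A$ includes that $T(A)\in\mathcal A$. $W_{u,T}f=(u\circ T)\cdot(f\circ T)$. $N_0=X$ and $N_k=\{x\in X: u(T^i(x))\neq 0\text{ for all }1\le i\le k\}$ for $k\ge 1$. For $k\ge 0$, $\mathcal E_k=\{x\in T^k(N_{k+1}):\exists\,y\in T^k(N_{k+1}),\ y\ne x,\ T(y)=T(x)\}$, and for $x\in\mathcal E_k$, $A_x^k=\{y\in\mathcal E_k: T(y)=T(x)\}$. The sets $A_x^k$ partition $\mathcal E_k$; $\mathcal E_1^k$ denotes a set obtained by choosing exactly one element from each distinct set $A_x^k$, and $\mathcal E_2^k=\mathcal E_k\setminus\mathcal E_1^k$. For a bounded operator $L$ with range $\mathcal R(L)$, the descent is $\beta(L)=\inf\{k\in\mathbb N\cup\{0\}:\mathcal R(L^{k+1})=\mathcal R(L^k)\}$ (equal to $\infty$ if no such $k$ exists). *)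

theory Defs
  imports "HOL-Analysis.Analysis" "HOL-Library.Extended_Nat"
begin

section \<open>Lorentz spaces\<close>

definition distr_fun :: "'a measure \<Rightarrow> ('a \<Rightarrow> complex) \<Rightarrow> real \<Rightarrow> ennreal" where
  "distr_fun M h s = emeasure M {x \<in> space M. norm (h x) > s}"

text \<open>The infimum is taken in \<^typ>\<open>ennreal\<close>, so that the infimum of the empty set is \<open>\<infinity>\<close>.\<close>

definition decr_rearr :: "'a measure \<Rightarrow> ('a \<Rightarrow> complex) \<Rightarrow> real \<Rightarrow> ennreal" where
  "decr_rearr M h t = (INF s\<in>{s::real. s > 0 \<and> distr_fun M h s \<le> ennreal t}. ennreal s)"

definition maximal_rearr :: "'a measure \<Rightarrow> ('a \<Rightarrow> complex) \<Rightarrow> real \<Rightarrow> ennreal" where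
  "maximal_rearr M h t = (\<integral>\<^sup>+ s \<in> {0<..<t}. decr_rearr M h s \<partial>lborel) / ennreal t"

text \<open>Real powers of extended nonnegative reals, only used for exponents \<open>a > 0\<close>.\<close>

definition ennreal_powr :: "ennreal \<Rightarrow> real \<Rightarrow> ennreal" where
  "ennreal_powr x a = (if x = \<infinity> then \<infinity> else ennreal (enn2real x powr a))"

definition lorentz_indices :: "ennreal \<Rightarrow> ennreal \<Rightarrow> bool" where
  "lorentz_indices p q \<longleftrightarrow>
     (1 < p \<and> p < \<infinity> \<and> 1 \<le> q \<and> q < \<infinity>) \<or> (1 < p \<and> p \<le> \<infinity> \<and> q = \<infinity>)"

text \<open>For \<open>p = \<infinity>\<close> the exponent \<open>1/p\<close> below is \<open>enn2real (1 / \<infinity>) = 0\<close>.\<close>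

definition lorentz_norm :: "'a measure \<Rightarrow> ennreal \<Rightarrow> ennreal \<Rightarrow> ('a \<Rightarrow> complex) \<Rightarrow> ennreal" where
  "lorentz_norm M p q h =
     (if q = \<infinity>
      then (SUP t\<in>{0<..}. ennreal (t powr enn2real (1 / p)) * maximal_rearr M h t)
      else ennreal_powr
             (q / p *
               (\<integral>\<^sup>+ t \<in> {0<..}.
                  ennreal_powr (ennreal (t powr enn2real (1 / p)) * maximal_rearr M h t) (enn2real q)
                    / ennreal t \<partial>lborel))
             (1 / enn2real q))"

definition lorentz_fun :: "'a measure \<Rightarrow> ennreal \<Rightarrow> ennreal \<Rightarrow> ('a \<Rightarrow> complex) set" where
  "lorentz_fun M p q = {h \<in> borel_measurable M. lorentz_norm M p q h < \<infinity>}"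

definition lorentz_ae :: "'a measure \<Rightarrow> ennreal \<Rightarrow> ennreal \<Rightarrow> (('a \<Rightarrow> complex) \<times> ('a \<Rightarrow> complex)) set" where
  "lorentz_ae M p q =
     {(f, g). f \<in> lorentz_fun M p q \<and> g \<in> lorentz_fun M p q \<and> (AE x in M. f x = g x)}"

definition lorentz_space :: "'a measure \<Rightarrow> ennreal \<Rightarrow> ennreal \<Rightarrow> ('a \<Rightarrow> complex) set set" where
  "lorentz_space M p q = lorentz_fun M p q // lorentz_ae M p q"

section \<open>Operators and descent\<close>

text \<open>Bounded linear operators on \<open>L(p,q)\<close>, given by their action on representatives.
  Applied to differences, the last two conditions imply compatibility with a.e. equality, so
  that such an operator acts on classes through \<open>lorentz_op\<close> below.\<close>

definition lorentz_bounded ::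
    "'a measure \<Rightarrow> ennreal \<Rightarrow> ennreal \<Rightarrow> (('a \<Rightarrow> complex) \<Rightarrow> 'a \<Rightarrow> complex) \<Rightarrow> bool" where
  "lorentz_bounded M p q W \<longleftrightarrow>
     (\<forall>f\<in>lorentz_fun M p q. W f \<in> lorentz_fun M p q) \<and>
     (\<forall>f\<in>lorentz_fun M p q. \<forall>g\<in>lorentz_fun M p q. \<forall>a b.
        AE x in M. W (\<lambda>x. a * f x + b * g x) x = a * W f x + b * W g x) \<and>
     (\<exists>K::real. \<forall>f\<in>lorentz_fun M p q.
        lorentz_norm M p q (W f) \<le> ennreal K * lorentz_norm M p q f)"

definition lorentz_op ::
    "'a measure \<Rightarrow> ennreal \<Rightarrow> ennreal \<Rightarrow> (('a \<Rightarrow> complex) \<Rightarrow> 'a \<Rightarrow> complex)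
      \<Rightarrow> ('a \<Rightarrow> complex) set \<Rightarrow> ('a \<Rightarrow> complex) set" where
  "lorentz_op M p q W C = lorentz_ae M p q `` (W ` C)"

text \<open>\<open>L\<close> is an operator on the carrier \<open>V\<close>; in \<^typ>\<open>enat\<close> the infimum of the empty set is \<open>\<infinity>\<close>.\<close>

definition descent :: "('b \<Rightarrow> 'b) \<Rightarrow> 'b set \<Rightarrow> enat" where
  "descent L V = Inf {enat k | k. (L ^^ Suc k) ` V = (L ^^ k) ` V}"

section \<open>Weighted composition operators\<close>

definition nonsingular :: "'a measure \<Rightarrow> ('a \<Rightarrow> 'a) \<Rightarrow> bool" where
  "nonsingular M T \<longleftrightarrow>
     (\<forall>A\<in>sets M. emeasure M A = 0 \<longrightarrow> emeasure M (T -` A \<inter> space M) = 0)"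

definition weighted_comp :: "('a \<Rightarrow> complex) \<Rightarrow> ('a \<Rightarrow> 'a) \<Rightarrow> ('a \<Rightarrow> complex) \<Rightarrow> 'a \<Rightarrow> complex" where
  "weighted_comp u T f = (\<lambda>x. u (T x) * f (T x))"

definition Nset :: "'a measure \<Rightarrow> ('a \<Rightarrow> complex) \<Rightarrow> ('a \<Rightarrow> 'a) \<Rightarrow> nat \<Rightarrow> 'a set" where
  "Nset M u T k = {x \<in> space M. \<forall>i\<in>{1..k}. u ((T ^^ i) x) \<noteq> 0}"

definition Tdom :: "'a measure \<Rightarrow> ('a \<Rightarrow> complex) \<Rightarrow> ('a \<Rightarrow> 'a) \<Rightarrow> nat \<Rightarrow> 'a set" where
  "Tdom M u T k = (T ^^ k) ` Nset M u T (Suc k)"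

definition Trestr :: "'a measure \<Rightarrow> ('a \<Rightarrow> complex) \<Rightarrow> ('a \<Rightarrow> 'a) \<Rightarrow> nat \<Rightarrow> 'a \<Rightarrow> 'a" where
  "Trestr M u T k = restrict T (Tdom M u T k)"

definition Eset :: "'a measure \<Rightarrow> ('a \<Rightarrow> complex) \<Rightarrow> ('a \<Rightarrow> 'a) \<Rightarrow> nat \<Rightarrow> 'a set" where
  "Eset M u T k = {x \<in> Tdom M u T k. \<exists>y\<in>Tdom M u T k. y \<noteq> x \<and> T y = T x}"

definition Aset :: "'a measure \<Rightarrow> ('a \<Rightarrow> complex) \<Rightarrow> ('a \<Rightarrow> 'a) \<Rightarrow> nat \<Rightarrow> 'a \<Rightarrow> 'a set" where
  "Aset M u T k x = {y \<in> Eset M u T k. T y = T x}"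

definition is_transversal :: "'a set \<Rightarrow> 'a set set \<Rightarrow> bool" where
  "is_transversal S P \<longleftrightarrow> S \<subseteq> \<Union>P \<and> (\<forall>A\<in>P. \<exists>!y. y \<in> S \<inter> A)"

section \<open>Basic facts\<close>

lemma descent_eq_infinity_iff:
  "descent L V = \<infinity> \<longleftrightarrow> (\<forall>k. (L ^^ Suc k) ` V \<noteq> (L ^^ k) ` V)"
proof
  assume inf: "descent L V = \<infinity>"
  show "\<forall>k. (L ^^ Suc k) ` V \<noteq> (L ^^ k) ` V"
  proof (intro allI notI)
    fix k assume "(L ^^ Suc k) ` V = (L ^^ k) ` V"
    then have "descent L V \<le> enat k"
      unfolding descent_def by (intro Inf_lower) blast
    with inf show False by simp
  qed
next
  assume "\<forall>k. (L ^^ Suc k) ` V \<noteq> (L ^^ k) ` V"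
  then have "{enat k | k. (L ^^ Suc k) ` V = (L ^^ k) ` V} = {}" by blast
  then show "descent L V = \<infinity>"
    unfolding descent_def by (simp only: Inf_empty top_enat_def)
qed

lemma Union_Aset: "(\<Union>x\<in>Eset M u T k. Aset M u T k x) = Eset M u T k"
  unfolding Aset_def by auto

lemma disjoint_Aset: "disjoint (Aset M u T k ` Eset M u T k)"
  unfolding disjoint_def Aset_def by auto

lemma lorentz_norm_cong_AE:
  assumes "f \<in> borel_measurable M" "g \<in> borel_measurable M" "AE x in M. f x = g x"
  shows "lorentz_norm M p q f = lorentz_norm M p q g"
proof -
  have "distr_fun M f = distr_fun M g"
    unfolding distr_fun_def using assms by (intro ext emeasure_eq_AE) auto
  then show ?thesis
    unfolding lorentz_norm_def maximal_rearr_def decr_rearr_def by simp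
qed

lemma equiv_lorentz_ae: "equiv (lorentz_fun M p q) (lorentz_ae M p q)"
  unfolding equiv_def refl_on_def sym_on_def trans_on_def lorentz_ae_def by auto

lemma AE_weighted_comp_cong:
  assumes T: "T \<in> measurable M M" "nonsingular M T"
    and fg: "AE x in M. f x = g x"
  shows "AE x in M. weighted_comp u T f x = weighted_comp u T g x"
proof -
  obtain N where N: "N \<in> sets M" "emeasure M N = 0" "{x \<in> space M. f x \<noteq> g x} \<subseteq> N"
    using fg by (auto elim!: AE_E)
  have "T -` N \<inter> space M \<in> null_sets M"
    using T N by (auto simp: nonsingular_def intro!: null_setsI measurable_sets)
  then show ?thesis
    by (rule AE_I') (use N(3) measurable_space[OF T(1)] in \<open>auto simp: weighted_comp_def\<close>)
qed

lemma lorentz_op_class: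
  assumes "T \<in> measurable M M" "nonsingular M T"
    and "lorentz_bounded M p q (weighted_comp u T)" and f: "f \<in> lorentz_fun M p q"
  shows "lorentz_op M p q (weighted_comp u T) (lorentz_ae M p q `` {f})
           = lorentz_ae M p q `` {weighted_comp u T f}"
proof -
  have W: "weighted_comp u T h \<in> lorentz_fun M p q" if "h \<in> lorentz_fun M p q" for h
    using assms(3) that by (auto simp: lorentz_bounded_def)
  have "(weighted_comp u T f, weighted_comp u T g) \<in> lorentz_ae M p q"
    if "(f, g) \<in> lorentz_ae M p q" for g
    using that W AE_weighted_comp_cong[OF assms(1,2), of f g u] by (auto simp: lorentz_ae_def)
  moreover have "(f, f) \<in> lorentz_ae M p q"
    using f by (simp add: lorentz_ae_def)
  ultimately show ?thesis
    using equiv_lorentz_ae[of M p q] unfolding lorentz_op_def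
    by (auto dest: equivE elim!: equivE intro: transD symD)
qed

end

theory Submission
  imports Defs
begin

text \<open>Take \<open>f\<close> to be the indicator of \<open>A\<^sub>1\<^sup>k\<close>, which has finite Lorentz norm. If \<open>W\<^sup>k f = W\<^sup>k\<^sup>+\<^sup>1 g\<close> a.e., then
  cancelling the non-zero product of the weights on \<open>N\<^sub>k\<^sub>+\<^sub>1\<close> gives \<open>f y = u (T y) * g (T y)\<close> for
  \<open>y \<in> T\<^sup>k(N\<^sub>k\<^sub>+\<^sub>1)\<close> outside a null set \<open>Z\<close>, because \<open>T\<close> maps null sets to null sets. So off \<open>Z\<close> the
  value \<open>f y\<close> depends only on \<open>T y\<close>. As \<open>f\<close> is \<open>1\<close> on \<open>A\<^sub>1\<^sup>k\<close> and \<open>0\<close> on \<open>A\<^sub>2\<^sup>k\<close>, which have the same image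
  under \<open>T\<close>, this forces \<open>A\<^sub>1\<^sup>k \<subseteq> Z \<union> T\<^sup>-\<^sup>1(T(Z))\<close>, a null set by non-singularity.\<close>

section \<open>Indicators of sets of finite measure have finite Lorentz norm\<close>

lemma decr_rearr_indicator_le:
  fixes A :: "'a set"
  assumes A: "A \<in> sets M" "emeasure M A \<le> ennreal a" and t: "0 \<le> t"
  shows "decr_rearr M (indicator A) t \<le> indicator {..<a} t"
proof -
  have distr: "distr_fun M (indicator A) s = (if s < 1 then emeasure M A else 0)" if "s > 0" for s
  proof -
    have "{x \<in> space M. norm (indicator A x :: complex) > s} = (if s < 1 then A else {})"
      using that sets.sets_into_space[OF A(1)] by (auto simp: indicator_def)
    then show ?thesis by (simp add: distr_fun_def)
  qed
  show ?thesis
  proof (cases "t < a")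
    case True
    have "decr_rearr M (indicator A) t \<le> ennreal 1"
      unfolding decr_rearr_def by (rule INF_lower) (simp add: distr)
    then show ?thesis using True by simp
  next
    case False
    \<comment> \<open>Level 0 is excluded from the infimum, so arbitrarily small s are used; each is
      admissible because the distribution function never exceeds \<open>emeasure M A\<close>, which
      is at most t here.\<close>
    have "decr_rearr M (indicator A) t \<le> ennreal s" if "s > 0" for s
    proof -
      have "emeasure M A \<le> ennreal t"
        using A(2) False by (meson ennreal_leI linorder_not_less order_trans)
      then show ?thesis
        unfolding decr_rearr_def by (intro INF_lower) (use that in \<open>simp add: distr\<close>)
    qed
    then have "decr_rearr M (indicator A) t \<le> 0"
      by - (rule ennreal_le_epsilon, simp)
    then show ?thesis by simp
  qed
qed

text \<open>Averages the previous bound over (0, t). An upper bound a replaces the exact measure so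
  that it can later be chosen positive.\<close>

lemma maximal_rearr_indicator_le:
  fixes A :: "'a set"
  assumes A: "A \<in> sets M" "emeasure M A \<le> ennreal a" and a: "0 \<le> a" and t: "0 < t"
  shows "maximal_rearr M (indicator A) t \<le> ennreal (min 1 (a / t))"
proof -
  have "(\<integral>\<^sup>+ s \<in> {0<..<t}. decr_rearr M (indicator A) s \<partial>lborel)
      \<le> (\<integral>\<^sup>+ s. indicator {0<..<min t a} s \<partial>lborel)"
  proof (intro nn_integral_mono)
    fix s :: real
    show "decr_rearr M (indicator A) s * indicator {0<..<t} s \<le> indicator {0<..<min t a} s"
      using decr_rearr_indicator_le[OF A, of s] by (cases "0 < s"; cases "s < t"; cases "s < a") auto
  qed
  also have "\<dots> = ennreal (min t a)"
    using a t by simp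
  finally have "maximal_rearr M (indicator A) t \<le> ennreal (min t a) / ennreal t"
    unfolding maximal_rearr_def by (rule divide_right_mono_ennreal)
  also have "\<dots> = ennreal (min 1 (a / t))"
    using a t by (subst divide_ennreal) (auto simp: min_def field_simps)
  finally show ?thesis .
qed

lemma ennreal_powr_mono: "x \<le> y \<Longrightarrow> 0 \<le> b \<Longrightarrow> ennreal_powr x b \<le> ennreal_powr y b"
  unfolding ennreal_powr_def
  by (auto simp: top_unique less_top intro!: ennreal_leI powr_mono2 enn2real_mono)

text \<open>The left side is nondecreasing up to t = a and nonincreasing after, so it peaks at a.
  With r = 1/p this settles q = \<infinity>; r = 0 is the case p = \<infinity>.\<close>

lemma powr_mult_min_le:
  fixes a t r :: real
  assumes "0 < a" "0 < t" "0 \<le> r" "r \<le> 1"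
  shows "t powr r * min 1 (a / t) \<le> a powr r"
proof (cases "t \<le> a")
  case True
  then have "t powr r * min 1 (a / t) \<le> t powr r * 1"
    by (intro mult_left_mono) auto
  also have "\<dots> \<le> a powr r"
    using True assms by (simp add: powr_mono2)
  finally show ?thesis .
next
  case False
  have "t powr r * min 1 (a / t) \<le> t powr r * (a / t)"
    by (intro mult_left_mono) auto
  also have "\<dots> = a * t powr (r - 1)"
    using assms by (simp add: powr_diff)
  also have "\<dots> \<le> a * a powr (r - 1)"
    using False assms by (intro mult_left_mono powr_mono2') auto
  also have "\<dots> = a powr r"
    using assms by (simp add: powr_diff)
  finally show ?thesis .
qed

text \<open>The integrand changes form at t = a: \<open>?f\<close> below, integrable at 0 since r >
  0, and \<open>?g\<close> above, integrable at infinity since r < 1. For r = 1/p these conditions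
  are p < \<infinity> and 1 < p.\<close>

lemma nn_integral_powr_mult_min_finite:
  fixes a r q :: real
  assumes "0 < a" "0 < r" "r < 1" "0 < q"
  shows "(\<integral>\<^sup>+ t \<in> {0<..}. ennreal ((t powr r * min 1 (a / t)) powr q / t) \<partial>lborel) < \<infinity>"
proof -
  let ?f = "\<lambda>t::real. t powr (r * q - 1)"
  let ?g = "\<lambda>t::real. a powr q * t powr ((r - 1) * q - 1)"
  have exps: "r * q - 1 > -1" "(r - 1) * q - 1 < -1"
    using assms by (auto simp: mult_less_0_iff)
  have f: "(\<integral>\<^sup>+ t. ennreal (?f t) * indicator {0..a} t \<partial>lborel)
      = ennreal (a powr (r * q - 1 + 1) / (r * q - 1 + 1))"
    using has_integral_powr_from_0[OF exps(1), of a] assms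
    by (intro nn_integral_has_integral_lebesgue') auto
  have g: "(\<integral>\<^sup>+ t. ennreal (?g t) * indicator {a..} t \<partial>lborel)
      = ennreal (a powr q * (-(a powr ((r - 1) * q - 1 + 1)) / ((r - 1) * q - 1 + 1)))"
    using has_integral_powr_to_inf[OF exps(2), of a] assms
    by (intro nn_integral_has_integral_lebesgue' has_integral_mult_right) auto
  have "(\<integral>\<^sup>+ t \<in> {0<..}. ennreal ((t powr r * min 1 (a / t)) powr q / t) \<partial>lborel)
      \<le> (\<integral>\<^sup>+ t. ennreal (?f t) * indicator {0..a} t + ennreal (?g t) * indicator {a..} t \<partial>lborel)"
  proof (intro nn_integral_mono)
    fix t :: real
    let ?h = "(t powr r * min 1 (a / t)) powr q / t"
    consider "t \<le> 0" | "0 < t" "t \<le> a" | "a < t" by linarith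
    then show "ennreal ?h * indicator {0<..} t
        \<le> ennreal (?f t) * indicator {0..a} t + ennreal (?g t) * indicator {a..} t"
    proof cases
      case 2
      then have "?h = ?f t"
        by (simp add: powr_powr powr_diff)
      then show ?thesis using 2 by simp
    next
      case 3
      then have t: "t > 0" using assms by simp
      then have "?h = (a * t powr (r - 1)) powr q / t"
        using 3 t by (simp add: powr_diff min_def mult.commute)
      also have "\<dots> = a powr q * t powr ((r - 1) * q) / t"
        using assms(1) by (simp add: powr_mult powr_powr)
      also have "\<dots> = ?g t"
        using t by (simp add: powr_diff)
      finally show ?thesis using 3 t by simp
    qed simp
  qed
  also have "\<dots> = (\<integral>\<^sup>+ t. ennreal (?f t) * indicator {0..a} t \<partial>lborel)
      + (\<integral>\<^sup>+ t. ennreal (?g t) * indicator {a..} t \<partial>lborel)"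
    by (rule nn_integral_add) auto
  also have "\<dots> < \<infinity>"
    unfolding f g by simp
  finally show ?thesis .
qed

lemma enn2real_inverse_bounds:
  fixes p :: ennreal
  assumes "1 < p"
  shows "0 \<le> enn2real (1 / p)" "enn2real (1 / p) < 1" "p < \<infinity> \<Longrightarrow> 0 < enn2real (1 / p)"
proof -
  have "enn2real (1 / p) < 1 \<and> (p < \<infinity> \<longrightarrow> 0 < enn2real (1 / p))"
  proof (cases p)
    case (real r)
    then have r: "1 < r" using assms
      by (metis ennreal_1 ennreal_less_iff zero_le_one)
    then have "1 / p = ennreal (1 / r)"
      using real by (metis divide_ennreal ennreal_1 less_trans zero_le_one zero_less_one)
    then show ?thesis using r by simp
  next
    case top
    then show ?thesis by simp
  qed
  then show "enn2real (1 / p) < 1" "p < \<infinity> \<Longrightarrow> 0 < enn2real (1 / p)" by auto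
qed simp

lemma indicator_in_lorentz_fun:
  fixes A :: "'a set"
  assumes pq: "lorentz_indices p q" and A: "A \<in> sets M" "emeasure M A < \<infinity>"
  shows "indicator A \<in> lorentz_fun M p q"
proof -
  \<comment> \<open>The summand 1 keeps a positive even for a null set A, as the power estimates
    require.\<close>
  define a where "a = measure M A + 1"
  have a: "0 < a" by (simp add: a_def add_nonneg_pos)
  have "emeasure M A = ennreal (measure M A)"
    using A(2) by (simp add: emeasure_eq_ennreal_measure)
  then have Aa: "emeasure M A \<le> ennreal a"
    by (simp add: a_def ennreal_leI)
  have p: "1 < p" using pq by (auto simp: lorentz_indices_def)
  define r where "r = enn2real (1 / p)"
  note r = enn2real_inverse_bounds[OF p, folded r_def]
  have weight: "ennreal (t powr r) * maximal_rearr M (indicator A) t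
      \<le> ennreal (t powr r * min 1 (a / t))" if "0 < t" for t
    using maximal_rearr_indicator_le[OF A(1) Aa _ that] a that
    by (auto simp: ennreal_mult intro: mult_left_mono)
  have "lorentz_norm M p q (indicator A) < \<infinity>"
  proof (cases "q = \<infinity>")
    case True
    have "(SUP t\<in>{0<..}. ennreal (t powr r) * maximal_rearr M (indicator A) t) \<le> ennreal (a powr r)"
      using powr_mult_min_le[OF a _ r(1)] r(2)
      by (intro SUP_least order_trans[OF weight] ennreal_leI) auto
    also have "\<dots> < \<infinity>" by simp
    finally show ?thesis
      unfolding lorentz_norm_def r_def[symmetric] if_P[OF True] .
  next
    case False
    then have q: "1 \<le> q" "q < \<infinity>" "p < \<infinity>" using pq by (auto simp: lorentz_indices_def)
    define s where "s = enn2real q"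
    have s: "0 < s"
      using q unfolding s_def by (auto simp: enn2real_positive_iff less_le_trans[OF zero_less_one])
    have bound: "ennreal_powr (ennreal (t powr r) * maximal_rearr M (indicator A) t) s / ennreal t
        \<le> ennreal ((t powr r * min 1 (a / t)) powr s / t)" if t: "0 < t" for t
    proof -
      have "ennreal_powr (ennreal (t powr r) * maximal_rearr M (indicator A) t) s / ennreal t
          \<le> ennreal_powr (ennreal (t powr r * min 1 (a / t))) s / ennreal t"
        using weight[OF t] s by (intro divide_right_mono_ennreal ennreal_powr_mono) auto
      also have "\<dots> = ennreal ((t powr r * min 1 (a / t)) powr s / t)"
        using t a by (simp add: ennreal_powr_def divide_ennreal)
      finally show ?thesis .
    qed
    have "(\<integral>\<^sup>+ t \<in> {0<..}.
          ennreal_powr (ennreal (t powr r) * maximal_rearr M (indicator A) t) s / ennreal t \<partial>lborel)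
        \<le> (\<integral>\<^sup>+ t \<in> {0<..}. ennreal ((t powr r * min 1 (a / t)) powr s / t) \<partial>lborel)"
      using bound by (intro nn_integral_mono) (auto simp: indicator_def)
    also have "\<dots> < \<infinity>"
      by (rule nn_integral_powr_mult_min_finite[OF a r(3)[OF q(3)] r(2) s])
    finally have int: "(\<integral>\<^sup>+ t \<in> {0<..}.
          ennreal_powr (ennreal (t powr r) * maximal_rearr M (indicator A) t) s / ennreal t \<partial>lborel) < \<infinity>" .
    have "q / p < \<infinity>"
      using p q by (auto simp: ennreal_divide_eq_top_iff less_top[symmetric])
    with int have "q / p * (\<integral>\<^sup>+ t \<in> {0<..}.
          ennreal_powr (ennreal (t powr r) * maximal_rearr M (indicator A) t) s / ennreal t \<partial>lborel) < \<infinity>"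
      by (simp add: ennreal_mult_less_top)
    then show ?thesis
      unfolding lorentz_norm_def r_def[symmetric] s_def[symmetric]
      using False by (simp add: ennreal_powr_def)
  qed
  then show ?thesis
    using A(1) by (simp add: lorentz_fun_def)
qed

section \<open>Iterates of the operator, on functions and on classes\<close>

lemma weighted_comp_funpow:
  "(weighted_comp u T ^^ k) f x = (\<Prod>i=1..k. u ((T ^^ i) x)) * f ((T ^^ k) x)"
proof (induction k arbitrary: x)
  case (Suc k)
  \<comment> \<open>Unfolding the outermost application leaves the k-th iterate at T x; its weights
    are the factors from i = 2 on, and \<open>u (T x)\<close> supplies i = 1.\<close>
  have "(\<Prod>i=1..k. u ((T ^^ i) (T x))) = (\<Prod>i=Suc 1..Suc k. u ((T ^^ i) x))"
    by (subst prod.shift_bounds_cl_Suc_ivl) (simp add: funpow_swap1)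
  then show ?case
    using Suc[of "T x"]
    by (simp add: weighted_comp_def funpow_swap1 prod.atLeast_Suc_atMost[of "Suc 0" "Suc k"] del: prod.cl_ivl_Suc)
qed simp

lemma weighted_comp_funpow_in_lorentz_fun:
  assumes "lorentz_bounded M p q (weighted_comp u T)" and "f \<in> lorentz_fun M p q"
  shows "(weighted_comp u T ^^ k) f \<in> lorentz_fun M p q"
  using assms by (induction k) (auto simp: lorentz_bounded_def)

text \<open>Lets an equality between classes in the ranges be read as an a.e. identity between
  iterates of representatives.\<close>

lemma lorentz_op_funpow_class:
  assumes "T \<in> measurable M M" "nonsingular M T"
    and "lorentz_bounded M p q (weighted_comp u T)" and "f \<in> lorentz_fun M p q"
  shows "(lorentz_op M p q (weighted_comp u T) ^^ k) (lorentz_ae M p q `` {f})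
           = lorentz_ae M p q `` {(weighted_comp u T ^^ k) f}"
proof (induction k)
  case (Suc k)
  then show ?case
    using lorentz_op_class[OF assms(1-3) weighted_comp_funpow_in_lorentz_fun[OF assms(3,4)]]
    by simp
qed simp

lemma null_sets_funpow_image:
  assumes "\<And>A. A \<in> sets M \<Longrightarrow> T ` A \<in> sets M \<and> emeasure M (T ` A) \<le> emeasure M A"
    and "N \<in> null_sets M"
  shows "(T ^^ k) ` N \<in> null_sets M"
proof (induction k)
  case (Suc k)
  then have "T ` (T ^^ k) ` N \<in> null_sets M"
    using assms(1)[of "(T ^^ k) ` N"] by (auto simp: null_sets_def)
  then show ?case by (simp add: image_comp comp_def)
qed (use assms(2) in simp)

section \<open>Consecutive powers have different ranges\<close>

theorem theorem4p19:
  fixes M :: "'a measure" and T :: "'a \<Rightarrow> 'a" and u :: "'a \<Rightarrow> complex"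
    and p q :: ennreal and E1 :: "nat \<Rightarrow> 'a set"
  assumes "sigma_finite_measure M" and "complete_measure M"
    and "lorentz_indices p q"
    and "T \<in> measurable M M" and "nonsingular M T"
    and "\<And>A. A \<in> sets M \<Longrightarrow> T ` A \<in> sets M \<and> emeasure M (T ` A) \<le> emeasure M A"
    and "u \<in> borel_measurable M" and "\<not> (AE x in M. u x = 0)"
    and "lorentz_bounded M p q (weighted_comp u T)"
    and "\<And>k. is_transversal (E1 k) (Aset M u T k ` Eset M u T k)"
    and "\<And>k. \<exists>A1 A2. A1 \<in> sets M \<and> A2 \<in> sets M
           \<and> A1 \<subseteq> E1 k \<and> A2 \<subseteq> Eset M u T k - E1 k
           \<and> 0 < emeasure M A1 \<and> emeasure M A1 < \<infinity>
           \<and> 0 < emeasure M A2 \<and> emeasure M A2 < \<infinity>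
           \<and> Trestr M u T k ` A1 = Trestr M u T k ` A2"
  shows "descent (lorentz_op M p q (weighted_comp u T)) (lorentz_space M p q) = \<infinity>"
proof -
  let ?W = "weighted_comp u T" and ?R = "lorentz_ae M p q"
  note T = \<open>T \<in> measurable M M\<close> and ns = \<open>nonsingular M T\<close>
    and contr = assms(6) and bdd = \<open>lorentz_bounded M p q ?W\<close>
  have "(lorentz_op M p q ?W ^^ Suc k) ` lorentz_space M p q
      \<noteq> (lorentz_op M p q ?W ^^ k) ` lorentz_space M p q" for k
  proof
    assume ranges: "(lorentz_op M p q ?W ^^ Suc k) ` lorentz_space M p q
      = (lorentz_op M p q ?W ^^ k) ` lorentz_space M p q"
    obtain A1 A2 where A: "A1 \<in> sets M" "A1 \<subseteq> E1 k" "A2 \<subseteq> Eset M u T k - E1 k"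
      "0 < emeasure M A1" "emeasure M A1 < \<infinity>" "Trestr M u T k ` A1 = Trestr M u T k ` A2"
      using assms(11)[of k] by blast
    have "E1 k \<subseteq> Eset M u T k"
      using assms(10)[of k] unfolding is_transversal_def Union_Aset by blast
    then have dom: "A1 \<subseteq> Tdom M u T k" "A2 \<subseteq> Tdom M u T k"
      using A(2,3) by (auto simp: Eset_def)
    have disj: "A1 \<inter> A2 = {}" using A(2,3) by blast
    \<comment> \<open>\<open>Trestr\<close> is \<open>undefined\<close> off \<open>Tdom\<close>, so
      its agreement with T on both sets rests on \<open>dom\<close>.\<close>
    have "Trestr M u T k ` A1 = T ` A1" "Trestr M u T k ` A2 = T ` A2"
      unfolding Trestr_def using dom by (auto intro!: image_cong restrict_apply')
    then have TA: "T ` A1 = T ` A2"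
      using A(6) by simp

    let ?f = "indicator A1 :: 'a \<Rightarrow> complex"
    have f: "?f \<in> lorentz_fun M p q"
      using indicator_in_lorentz_fun[OF assms(3) A(1,5)] .
    \<comment> \<open>The equality of ranges is used in one direction only, for the class of
      \<open>?f\<close>.\<close>
    have "(lorentz_op M p q ?W ^^ k) (?R `` {?f}) \<in> (lorentz_op M p q ?W ^^ Suc k) ` lorentz_space M p q"
      unfolding ranges unfolding lorentz_space_def using f by (intro imageI quotientI)
    then obtain C where C: "C \<in> lorentz_space M p q"
      "(lorentz_op M p q ?W ^^ k) (?R `` {?f}) = (lorentz_op M p q ?W ^^ Suc k) C"
      by blast
    obtain g where g: "g \<in> lorentz_fun M p q" "C = ?R `` {g}"
      using C(1) unfolding lorentz_space_def by (rule quotientE)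
    have "?R `` {(?W ^^ k) ?f} = ?R `` {(?W ^^ Suc k) g}"
      using C(2) unfolding g(2) lorentz_op_funpow_class[OF T ns bdd f]
        lorentz_op_funpow_class[OF T ns bdd g(1)] .
    then have "((?W ^^ k) ?f, (?W ^^ Suc k) g) \<in> ?R"
      using eq_equiv_class[OF _ equiv_lorentz_ae]
        weighted_comp_funpow_in_lorentz_fun[OF bdd g(1)] by blast
    then have "AE x in M. (?W ^^ k) ?f x = (?W ^^ Suc k) g x"
      by (simp add: lorentz_ae_def)
    then obtain N where N: "N \<in> null_sets M"
      "{x \<in> space M. (?W ^^ k) ?f x \<noteq> (?W ^^ Suc k) g x} \<subseteq> N"
      by (auto elim!: AE_E simp: null_sets_def)

    \<comment> \<open>N consists of points x, while the identity sought lives at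
      \<open>(T ^^ k) x\<close>. With the full image removed, every preimage of a remaining point
      avoids N.\<close>
    define Z where "Z = (T ^^ k) ` N"
    have Z: "Z \<in> null_sets M"
      unfolding Z_def by (rule null_sets_funpow_image[OF contr N(1)])
    have cancel: "?f y = u (T y) * g (T y)" if y: "y \<in> Tdom M u T k - Z" for y
    proof -
      obtain x where x: "x \<in> Nset M u T (Suc k)" "y = (T ^^ k) x"
        using y by (auto simp: Tdom_def)
      have "x \<notin> N" using y x(2) by (auto simp: Z_def)
      then have "(?W ^^ k) ?f x = (?W ^^ Suc k) g x"
        using N(2) x(1) by (auto simp: Nset_def)
      \<comment> \<open>Both sides share the weights for i = 1..k, nonzero on
        \<open>Nset M u T (Suc k)\<close>; the extra weight at i = k + 1 is the
        \<open>u (T y)\<close> that remains.\<close>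
      moreover have "(\<Prod>i=1..k. u ((T ^^ i) x)) \<noteq> 0"
        using x(1) by (auto simp: Nset_def)
      ultimately show ?thesis
        unfolding weighted_comp_funpow x(2) by (simp add: mult.assoc)
    qed
    have "T y \<in> T ` Z" if y: "y \<in> A1 - Z" for y
    proof -
      obtain z where z: "z \<in> A2" "T y = T z"
        using TA y by blast
      \<comment> \<open>Otherwise \<open>cancel\<close> applies at both points and gives equal
        values of \<open>?f\<close>, which is 1 at y and 0 at z.\<close>
      have "z \<in> Z"
      proof (rule ccontr)
        assume "z \<notin> Z"
        then have "y \<in> Tdom M u T k - Z" "z \<in> Tdom M u T k - Z"
          using y z(1) dom by blast+
        then have "?f y = ?f z"
          using z(2) cancel by metis
        then show False using y z(1) disj by (auto simp: indicator_def)
      qed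
      then show ?thesis using z(2) by blast
    qed
    then have sub: "A1 \<subseteq> Z \<union> (T -` (T ` Z) \<inter> space M)"
      using sets.sets_into_space[OF A(1)] by blast
    \<comment> \<open>Non-singularity applies to measurable null sets; the image of Z is one because
      T preserves measurability forward without increasing measure.\<close>
    have "T ` Z \<in> null_sets M"
      using null_sets_funpow_image[OF contr Z, of 1] by simp
    then have "T -` (T ` Z) \<inter> space M \<in> null_sets M"
      using ns T by (auto simp: nonsingular_def intro!: null_setsI measurable_sets)
    then have "Z \<union> (T -` (T ` Z) \<inter> space M) \<in> null_sets M"
      using Z by (rule null_sets.Un[rotated])
    then have "emeasure M A1 = 0"
      using null_sets_subset[OF _ A(1) sub] by auto
    then show False using A(4) by simp
  qed
  then show ?thesis
    unfolding descent_eq_infinity_iff by blast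
qed

end
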